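(* Let $\Psi=(\psi_1,\ldots,\psi_r)\in\mathbb{R}^{m\times r}$ with $\max_{1\le j\le r}\|\psi_j\|_2\le 1$. Suppose that there exists a nested sequence of approximations for $\Psi$, with parameters $(q,\gamma,W)$. Then $$M(\epsilon,\Psi\otimes\Psi)\lesssim\epsilon^{-W}\log^{\frac{2+W}{2}}(1/\epsilon).$$
   Context: $\|\cdot\|_2$ is the Euclidean norm. $\Psi\otimes\Psi\in\mathbb{R}^{m^2\times r^2}$ is the tensor (Kronecker) product, whose columns are $\psi_{j_1}\otimes\psi_{j_2}$, $j_1,j_2\in\{1,\ldots,r\}$. For a matrix $X=(x_1,\ldots,x_p)\in\mathbb{R}^{n\times p}$ and a linear space $\mathcal{V}\subset\mathbb{R}^n$, let $x^{\mathcal{V}^\perp}$ be the projection of $x$ on the orthocomplement of $\mathcal{V}$, and $\delta(\mathcal{V},X):=\max_{1\le j\le p}\|x_j^{\mathcal{V}^\perp}\|_2$. For $N\in\mathbb{N}$ put $\delta_N(X):=\min\{\delta(\mathcal{V},X):\dim(\mathcal{V})=N\}$, and for $\epsilon>0$ put $M(\epsilon,X):=\min\{N:\delta_N(X)\le\epsilon\}$. Given $q\in\mathbb{N}$, a nested sequence of linear spaces with starting value $q$ is a sequence $\{\mathcal{V}_k\}_{k\ge0}$ where $\mathcal{V}_0$ is a $q$-dimensional linear subspace of $\mathbb{R}^m$ and, for $k=1,2,\ldots$, $\mathcal{V}_k\supset\mathcal{V}_{k-1}$ is a linear space with dimension $q2^k$. For $q\in\mathbb{N}$, $\gamma>0$,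 $W>0$, a nested sequence of approximations for $\Psi$ with parameters $(q,\gamma,W)$ is a nested sequence of linear spaces $\{\mathcal{V}_k\}_{k\ge0}$ with starting value $q$ such that $\delta(\mathcal{V}_k,\Psi)\le\gamma2^{-k/W}$ for all $k\in\mathbb{N}=\{1,2,\ldots\}$. If $g$ and $h$ are functions on $(0,1]$, with $h$ possibly depending on the matrix dimensions but $g$ not, then $h(\epsilon)\lesssim g(\epsilon)$ means $\limsup_{\epsilon\downarrow0}h(\epsilon)/g(\epsilon)\le C<\infty$, where $C$ does not depend on the matrix dimensions.
   Formalization: The dimension of V_k in a nested sequence is taken to be min(q2^k, m) instead of q2^k, since subspaces of R^m cannot have dimension q2^k once q2^k > m; as literally defined, no infinite nested sequence exists. *)

theory Defs
  imports Complex_Main "HOL-Library.Extended_Real" "Jordan_Normal_Form.VS_Connect"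
begin

text \<open>
  The constants hidden in the asymptotic statement must not depend on the dimensions, so the
  dimensions have to be bound variables.  We therefore use the matrices of Jordan_Normal_Form,
  whose dimensions are natural numbers; indices start at 0.
\<close>

definition norm2 :: "real vec \<Rightarrow> real" where
  "norm2 x = sqrt (x \<bullet> x)"

text \<open>Column \<open>j1 * dim_col B + j2\<close> of \<open>kron A B\<close> is \<open>col A j1 \<otimes> col B j2\<close>.\<close>

definition kron :: "real mat \<Rightarrow> real mat \<Rightarrow> real mat" where
  "kron A B = mat (dim_row A * dim_row B) (dim_col A * dim_col B)
     (\<lambda>(i, j). A $$ (i div dim_row B, j div dim_col B) * B $$ (i mod dim_row B, j mod dim_col B))"

definition lin_subspace :: "nat \<Rightarrow> real vec set \<Rightarrow> bool" where
  "lin_subspace n V \<longleftrightarrow> subspace class_ring V (module_vec TYPE(real) n)"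

definition sdim :: "nat \<Rightarrow> real vec set \<Rightarrow> nat" where
  "sdim n V = vectorspace.dim class_ring (module_vec TYPE(real) n\<lparr>carrier := V\<rparr>)"

definition proj_perp :: "nat \<Rightarrow> real vec set \<Rightarrow> real vec \<Rightarrow> real vec" where
  "proj_perp n V x = (THE y. y \<in> vec_module.orthogonal_complement n V \<and> x - y \<in> V)"

definition delta :: "real vec set \<Rightarrow> real mat \<Rightarrow> real" where
  "delta V X = (MAX j\<in>{..<dim_col X}. norm2 (proj_perp (dim_row X) V (col X j)))"

text \<open>
  For \<open>N \<le> dim_row X\<close> the minimum over all \<open>N\<close>-dimensional subspaces is attained, by compactness
  of the set of orthonormal systems of \<open>N\<close> vectors, so it equals this infimum.
\<close>

definition delta_N :: "nat \<Rightarrow> real mat \<Rightarrow> real" where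
  "delta_N N X = Inf {delta V X | V. lin_subspace (dim_row X) V \<and> sdim (dim_row X) V = N}"

text \<open>
  \<open>N\<close> ranges over the positive integers for which an \<open>N\<close>-dimensional subspace exists.
\<close>

definition M_approx :: "real \<Rightarrow> real mat \<Rightarrow> nat" where
  "M_approx \<epsilon> X = (LEAST N. 1 \<le> N \<and> N \<le> dim_row X \<and> delta_N N X \<le> \<epsilon>)"

text \<open>
  No subspace of \<open>\<real>^m\<close> has a dimension larger than \<open>m\<close>, so the prescribed dimension \<open>q * 2 ^ k\<close> is
  capped at \<open>m\<close>: the sequence is constantly equal to the whole space once \<open>q * 2 ^ k \<ge> m\<close>.
  Without the cap no such infinite sequence would exist for \<open>q \<ge> 1\<close>.
\<close>

definition nested_spaces :: "nat \<Rightarrow> nat \<Rightarrow> (nat \<Rightarrow> real vec set) \<Rightarrow> bool" where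
  "nested_spaces m q V \<longleftrightarrow>
     lin_subspace m (V 0) \<and> sdim m (V 0) = q \<and>
     (\<forall>k\<ge>1. lin_subspace m (V k) \<and> V (k - 1) \<subseteq> V k \<and> sdim m (V k) = min (q * 2 ^ k) m)"

definition nested_approximations ::
  "nat \<Rightarrow> real \<Rightarrow> real \<Rightarrow> real mat \<Rightarrow> (nat \<Rightarrow> real vec set) \<Rightarrow> bool" where
  "nested_approximations q \<gamma> W \<Psi> V \<longleftrightarrow>
     nested_spaces (dim_row \<Psi>) q V \<and>
     (\<forall>k\<ge>1. delta (V k) \<Psi> \<le> \<gamma> * 2 powr (- real k / W))"

text \<open>
  For functions \<open>h i\<close>, where the index \<open>i\<close> ranges over data of all possible dimensions:
  \<open>limsup h i \<epsilon> / g \<epsilon> \<le> C\<close> as \<open>\<epsilon>\<close> decreases to 0, uniformly in \<open>i\<close>.  The uniformity matters: if \<open>h i\<close>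
  is bounded for each \<open>i\<close> and \<open>g\<close> is unbounded, the limsup for a single \<open>i\<close> is 0.
\<close>

definition dimfree_lesssim :: "'i set \<Rightarrow> ('i \<Rightarrow> real \<Rightarrow> real) \<Rightarrow> (real \<Rightarrow> real) \<Rightarrow> bool" where
  "dimfree_lesssim I h g \<longleftrightarrow>
     (\<exists>C::real. Limsup (at_right 0) (\<lambda>\<epsilon>. SUP i\<in>I. ereal (h i \<epsilon> / g \<epsilon>)) \<le> ereal C)"

lemma dimfree_lesssim_pointwise:
  assumes "dimfree_lesssim I h g"
  shows "\<exists>C::real. \<forall>i\<in>I. Limsup (at_right 0) (\<lambda>\<epsilon>. ereal (h i \<epsilon> / g \<epsilon>)) \<le> ereal C"
proof -
  obtain C :: real where
    C: "Limsup (at_right 0) (\<lambda>\<epsilon>. SUP i\<in>I. ereal (h i \<epsilon> / g \<epsilon>)) \<le> ereal C"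
    using assms unfolding dimfree_lesssim_def by blast
  have "Limsup (at_right 0) (\<lambda>\<epsilon>. ereal (h i \<epsilon> / g \<epsilon>)) \<le> ereal C" if "i \<in> I" for i
    by (rule order_trans[OF Limsup_mono C]) (intro always_eventually allI SUP_upper that)
  then show ?thesis by blast
qed

end

theory Submission
  imports Defs "HOL-Real_Asymp.Real_Asymp"
begin

text \<open>
  The columns of \<open>\<Psi> \<otimes> \<Psi>\<close> are the products \<open>a \<otimes> b\<close> of columns of \<open>\<Psi>\<close>.  The full tensor product
  \<open>V K \<otimes> V K\<close> would approximate them with error of order \<open>2 powr (- K / W)\<close>, but its dimension is of
  order \<open>2 ^ (2 * K)\<close>, which leads to the rate \<open>\<epsilon> powr (- 2 * W)\<close>.  The bound comes from a sparse grid
  (hyperbolic cross) instead: the sum of the spaces \<open>V k \<otimes> V (K - k)\<close> over \<open>k \<le> K\<close>.  Each of these has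
  dimension at most \<open>q * 2 ^ k * (q * 2 ^ (K - k)) = q\<^sup>2 * 2 ^ K\<close>, so the sum has dimension at most
  \<open>(K + 1) * q\<^sup>2 * 2 ^ K\<close> (\<open>sparse_tensor_space\<close>).

  Compared with the full tensor product, the error grows by the square root of the number of levels
  only (\<open>tensor_residual\<close>).  Splitting \<open>a\<close> into its orthogonal increments between consecutive spaces, the \<open>k\<close>-th increment has
  norm of order \<open>2 powr (- k / W)\<close> and is multiplied by \<open>b\<close>, which \<open>V (K - k)\<close> approximates up to
  \<open>\<gamma> * 2 powr (- (K - k) / W)\<close>.  Every level thus contributes an error of order \<open>2 powr (- K / W)\<close>, and
  the contributions are orthogonal, so the total error is of order \<open>sqrt (K + 2) * 2 powr (- K / W)\<close>.
  The constants involve \<open>q\<close>, \<open>\<gamma>\<close> and \<open>W\<close> only (\<open>M_approx_kron_le\<close>).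

  Making this error equal to \<open>\<epsilon>\<close> requires \<open>K\<close> of order \<open>ln (1 / \<epsilon>)\<close> and \<open>2 ^ K\<close> of order
  \<open>(sqrt (ln (1 / \<epsilon>)) / \<epsilon>) powr W\<close> (\<open>resolution_level\<close>).  In the exponent \<open>(2 + W) / 2 = 1 + W / 2\<close> of the
  logarithm, 1 comes from the number \<open>K + 1\<close> of summands and \<open>W / 2\<close> from the square root in the error.
  Since \<open>K\<close> depends on \<open>\<epsilon>\<close> but not on \<open>\<Psi>\<close>, the estimate is uniform in the dimensions.
\<close>

section \<open>Subspaces and their dimension\<close>

lemma lin_subspaceI:
  assumes "V \<subseteq> carrier_vec n" "0\<^sub>v n \<in> V"
    and "\<And>x y. x \<in> V \<Longrightarrow> y \<in> V \<Longrightarrow> x + y \<in> V"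
    and "\<And>c x. x \<in> V \<Longrightarrow> c \<cdot>\<^sub>v x \<in> V"
  shows "lin_subspace n V"
  using assms unfolding lin_subspace_def
  by (intro subspace.intro vec_vs submodule.intro vec_module)
     (auto simp: module_vec_simps class_ring_simps)

lemma lin_subspaceD:
  assumes "lin_subspace n V"
  shows "V \<subseteq> carrier_vec n" "0\<^sub>v n \<in> V"
    and "x \<in> V \<Longrightarrow> y \<in> V \<Longrightarrow> x + y \<in> V"
    and "x \<in> V \<Longrightarrow> c \<cdot>\<^sub>v x \<in> V"
proof -
  have s: "submodule class_ring V (module_vec TYPE(real) n)"
    using assms unfolding lin_subspace_def subspace_def by simp
  show "V \<subseteq> carrier_vec n" "x \<in> V \<Longrightarrow> y \<in> V \<Longrightarrow> x + y \<in> V" "x \<in> V \<Longrightarrow> c \<cdot>\<^sub>v x \<in> V"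
    using submodule.subset[OF s] submodule.m_closed[OF s] submodule.smult_closed[OF s]
    by (auto simp: module_vec_simps class_ring_simps)
  interpret vec_space "TYPE(real)" n .
  show "0\<^sub>v n \<in> V"
    using submodule.zero_closed[OF s] by (simp add: module_vec_simps)
qed

lemma lin_subspace_minus:
  assumes "lin_subspace n V" "x \<in> V" "y \<in> V"
  shows "x - y \<in> V"
proof -
  have c: "x \<in> carrier_vec n" "y \<in> carrier_vec n" using assms lin_subspaceD(1) by blast+
  have "x - y = x + (-1) \<cdot>\<^sub>v y" using c by auto
  then show ?thesis using lin_subspaceD(3,4)[OF assms(1)] assms(2,3) by simp
qed

text \<open>
  A basis is recorded by its number of elements and by the fact that every subspace containing it
  contains \<open>V\<close>.  In this form a statement about all of \<open>V\<close> follows from the statement about the basis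
  as soon as the vectors satisfying it form a subspace; no linear combination has to be written down.
  It exists because a linearly independent subset of \<open>V\<close> has at most \<open>n\<close> elements, so that a maximal
  one exists.
\<close>

lemma lin_subspace_basis:
  assumes V: "lin_subspace n V"
  obtains B where "finite B" "B \<subseteq> V" "card B = sdim n V"
    "\<And>W. lin_subspace n W \<Longrightarrow> B \<subseteq> W \<Longrightarrow> V \<subseteq> W" "sdim n V \<le> n"
proof -
  interpret vec_space "TYPE(real)" n .
  have sub: "subspace class_ring V (module_vec TYPE(real) n)"
    using V by (simp add: lin_subspace_def)
  have sm: "submodule class_ring V (module_vec TYPE(real) n)"
    using sub by (simp add: subspace_def)
  interpret S: vectorspace class_ring "vs V"
    by (rule subspace_is_vs[OF sub])
  have Vc: "V \<subseteq> carrier_vec n" by (rule lin_subspaceD(1)[OF V])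
  have indep: "finite A \<and> card A \<le> n" if "A \<subseteq> carrier (vs V) \<and> S.lin_indpt A" for A
  proof -
    have "A \<subseteq> V" using that by simp
    moreover from this have "lin_indpt A" using span_li_not_depend(2)[OF _ sm] that by simp
    ultimately show ?thesis using li_le_dim[OF fin_dim, of A] Vc dim_is_n by auto
  qed
  have "{} \<subseteq> carrier (vs V) \<and> S.lin_indpt {}" by (simp add: S.lin_dep_def)
  from maximal_exists[of "\<lambda>A. A \<subseteq> carrier (vs V) \<and> S.lin_indpt A", OF indep this]
  obtain B where B: "finite B" "S.basis B"
    using S.max_li_is_basis by blast
  have dimB: "S.dim = card B" by (rule S.dim_basis[OF B])
  have BV: "B \<subseteq> V" "S.span B = V" "S.lin_indpt B" using B(2) by (auto simp: S.basis_def)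
  have sp: "span B = V" using span_li_not_depend(1)[OF BV(1) sm] BV(2) by simp
  show ?thesis
  proof
    show "finite B" "B \<subseteq> V" by fact+
    show "card B = sdim n V" using dimB by (simp add: sdim_def)
    show "sdim n V \<le> n" using dimB indep[of B] BV by (simp add: sdim_def)
    fix W assume "lin_subspace n W" "B \<subseteq> W"
    then have "submodule class_ring W (module_vec TYPE(real) n)"
      by (simp add: lin_subspace_def subspace_def)
    from span_is_subset[OF \<open>B \<subseteq> W\<close> this] show "V \<subseteq> W" using sp by simp
  qed
qed

lemma lin_subspace_generated:
  assumes "finite S" "S \<subseteq> carrier_vec n"
  obtains U where "lin_subspace n U" "S \<subseteq> U" "sdim n U \<le> card S"
proof -
  interpret vec_space "TYPE(real)" n .
  have sub: "subspace class_ring (span S) (module_vec TYPE(real) n)"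
    using span_is_subspace assms by simp
  have sm: "submodule class_ring (span S) (module_vec TYPE(real) n)"
    using sub by (simp add: subspace_def)
  interpret S: vectorspace class_ring "vs (span S)"
    by (rule subspace_is_vs[OF sub])
  have SS: "S \<subseteq> span S" using in_own_span assms by simp
  have "S.span S = span S" using span_li_not_depend(1)[OF SS sm] .
  then have "S.dim \<le> card S" using S.gen_ge_dim[OF assms(1)] SS by simp
  with that[of "span S"] sub SS show ?thesis by (simp add: lin_subspace_def sdim_def)
qed

section \<open>Orthogonal projection\<close>

lemma scalar_prod_self_eq_0:
  assumes "(x :: real vec) \<in> carrier_vec n" "x \<bullet> x = 0"
  shows "x = 0\<^sub>v n"
  using assms conjugate_square_eq_0_vec[of x n] by simp

lemma lin_subspace_annihilator:
  assumes "y \<in> carrier_vec n"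
  shows "lin_subspace n {z \<in> carrier_vec n. y \<bullet> z = 0}"
  by (rule lin_subspaceI) (use assms in \<open>auto simp: scalar_prod_add_distrib\<close>)

text \<open>
  Gram-Schmidt, one vector at a time.  To add \<open>s\<close>, split off the part \<open>e\<close> of \<open>s\<close> orthogonal to the old
  vectors and correct the residual of \<open>x\<close> along \<open>e\<close>.  Since \<open>e\<close> is orthogonal to the old vectors, the
  correction does not destroy the orthogonality to them.  That \<open>v\<close> lies in every subspace containing
  \<open>S\<close> says that it is in the span of \<open>S\<close>.
\<close>

lemma orthogonal_decomposition_finite:
  assumes "finite S" "S \<subseteq> carrier_vec n" "x \<in> carrier_vec n"
  shows "\<exists>v\<in>carrier_vec n. (\<forall>W. lin_subspace n W \<longrightarrow> S \<subseteq> W \<longrightarrow> v \<in> W) \<and> (\<forall>s\<in>S. (x - v) \<bullet> s = 0)"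
  using assms
proof (induction S arbitrary: x rule: finite_induct)
  case empty
  then show ?case by (intro bexI[of _ "0\<^sub>v n"]) (auto dest: lin_subspaceD(2))
next
  case (insert s S)
  then have cs[simp]: "s \<in> carrier_vec n" "x \<in> carrier_vec n" and Sc: "S \<subseteq> carrier_vec n" by auto
  obtain v where v[simp]: "v \<in> carrier_vec n" and vW: "\<And>W. lin_subspace n W \<Longrightarrow> S \<subseteq> W \<Longrightarrow> v \<in> W"
    and vS: "\<And>t. t \<in> S \<Longrightarrow> (x - v) \<bullet> t = 0"
    using insert.IH[OF Sc cs(2)] by blast
  obtain w where w[simp]: "w \<in> carrier_vec n" and wW: "\<And>W. lin_subspace n W \<Longrightarrow> S \<subseteq> W \<Longrightarrow> w \<in> W"
    and wS: "\<And>t. t \<in> S \<Longrightarrow> (s - w) \<bullet> t = 0"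
    using insert.IH[OF Sc cs(1)] by blast
  define e where "e = s - w"
  have e[simp]: "e \<in> carrier_vec n" by (simp add: e_def)
  \<comment> \<open>If \<open>e = 0\<close>, then \<open>c = 0\<close> by division by zero, and no correction is needed.\<close>
  define c where "c = ((x - v) \<bullet> e) / (e \<bullet> e)"
  define y where "y = x - (v + c \<cdot>\<^sub>v e)"
  have y[simp]: "y \<in> carrier_vec n" by (simp add: y_def)
  have y_alt: "y = (x - v) - c \<cdot>\<^sub>v e" unfolding y_def
    by (intro eq_vecI) (simp_all add: carrier_vecD[OF v] carrier_vecD[OF e] carrier_vecD[OF cs(2)])
  have yt: "y \<bullet> t = (x - v) \<bullet> t - c * (e \<bullet> t)" if "t \<in> carrier_vec n" for t
    unfolding y_alt using that by (subst minus_scalar_prod_distrib[of _ n]) auto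
  have yS: "y \<bullet> t = 0" if "t \<in> S" for t
    using that yt[of t] vS[of t] wS[of t] Sc by (auto simp: e_def)
  have "y \<bullet> w = 0" using wW[OF lin_subspace_annihilator[OF y]] yS Sc by auto
  moreover have "y \<bullet> e = 0"
  proof (cases "e \<bullet> e = 0")
    case True
    then have "e = 0\<^sub>v n" using scalar_prod_self_eq_0[OF e] by simp
    then show ?thesis by simp
  next
    case False
    then show ?thesis using yt[OF e] by (simp add: c_def)
  qed
  moreover have "s = e + w"
    unfolding e_def by (intro eq_vecI) (simp_all add: carrier_vecD[OF w] carrier_vecD[OF cs(1)])
  ultimately have "y \<bullet> s = 0" by (simp add: scalar_prod_add_distrib[of _ n])
  with yS have "\<forall>t\<in>insert s S. (x - (v + c \<cdot>\<^sub>v e)) \<bullet> t = 0" by (simp add: y_def)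
  moreover have "v + c \<cdot>\<^sub>v e \<in> W" if W: "lin_subspace n W" "insert s S \<subseteq> W" for W
  proof -
    have "e \<in> W" unfolding e_def using W wW[of W] lin_subspace_minus by auto
    then show ?thesis using W vW[of W] lin_subspaceD(3,4)[OF W(1)] by auto
  qed
  ultimately show ?case by (intro bexI[of _ "v + c \<cdot>\<^sub>v e"]) auto
qed

text \<open>
  Existence and uniqueness justify the description operator in \<^const>\<open>proj_perp\<close>.  Uniqueness: the
  difference of two candidates lies in \<open>V\<close> and is orthogonal to \<open>V\<close>, hence to itself.
\<close>

lemma proj_perp_props:
  assumes V: "lin_subspace n V" and x: "x \<in> carrier_vec n"
  shows "proj_perp n V x \<in> carrier_vec n"
    and "\<And>v. v \<in> V \<Longrightarrow> proj_perp n V x \<bullet> v = 0"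
    and "x - proj_perp n V x \<in> V"
proof -
  interpret vec_module "TYPE(real)" n .
  obtain B where B: "finite B" "B \<subseteq> V" "\<And>W. lin_subspace n W \<Longrightarrow> B \<subseteq> W \<Longrightarrow> V \<subseteq> W"
    using lin_subspace_basis[OF V] by metis
  have Vc: "V \<subseteq> carrier_vec n" by (rule lin_subspaceD(1)[OF V])
  obtain v where v: "v \<in> carrier_vec n" "v \<in> V" "\<And>s. s \<in> B \<Longrightarrow> (x - v) \<bullet> s = 0"
    using orthogonal_decomposition_finite[of B n x] B Vc V x by blast
  let ?P = "\<lambda>y. y \<in> orthogonal_complement V \<and> x - y \<in> V"
  have c: "x - v \<in> carrier_vec n" using v x by simp
  have "V \<subseteq> {z \<in> carrier_vec n. (x - v) \<bullet> z = 0}"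
    by (rule B(3)[OF lin_subspace_annihilator[OF c]]) (use B Vc v in auto)
  moreover have "x - (x - v) = v" using v x by (intro eq_vecI) auto
  ultimately have ex: "?P (x - v)"
    using v(2) c unfolding orthogonal_complement_def by auto
  have uniq: "y = z" if y: "?P y" and z: "?P z" for y z
  proof -
    have yc: "y \<in> carrier_vec n" "z \<in> carrier_vec n"
      using y z by (auto simp: orthogonal_complement_def)
    have "(x - z) - (x - y) = y - z" using yc x by (intro eq_vecI) auto
    then have d: "y - z \<in> V" using lin_subspace_minus[OF V, of "x - z" "x - y"] y z by simp
    have "(y - z) \<bullet> (y - z) = y \<bullet> (y - z) - z \<bullet> (y - z)"
      using yc by (subst minus_scalar_prod_distrib[of _ n]) auto
    also have "\<dots> = 0" using y z d by (auto simp: orthogonal_complement_def)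
    finally have "y - z = 0\<^sub>v n" using scalar_prod_self_eq_0[of "y - z" n] yc by simp
    moreover have "y = (y - z) + z" using yc by (intro eq_vecI) auto
    ultimately show ?thesis using yc by simp
  qed
  have "?P (proj_perp n V x)"
    unfolding proj_perp_def by (rule theI[of ?P]) (use ex uniq in blast)+
  then show "proj_perp n V x \<in> carrier_vec n" "\<And>v. v \<in> V \<Longrightarrow> proj_perp n V x \<bullet> v = 0"
    "x - proj_perp n V x \<in> V"
    by (auto simp: orthogonal_complement_def)
qed

lemma scalar_prod_self_add:
  assumes "(x :: real vec) \<in> carrier_vec n" "y \<in> carrier_vec n" "x \<bullet> y = 0"
  shows "(x + y) \<bullet> (x + y) = x \<bullet> x + y \<bullet> y"
proof -
  have "y \<bullet> x = 0" using assms comm_scalar_prod[of x n y] by simp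
  then show ?thesis using assms
    by (simp add: add_scalar_prod_distrib[of _ n] scalar_prod_add_distrib[of _ n])
qed

lemma scalar_prod_self_nonneg: "(x :: real vec) \<bullet> x \<ge> 0"
  by (simp add: scalar_prod_def sum_nonneg)

text \<open>
  The projection is the best approximation: to bound \<^const>\<open>proj_perp\<close> it suffices to exhibit one good
  approximant in \<open>V\<close>.
\<close>

lemma proj_perp_le:
  assumes V: "lin_subspace n V" and x: "x \<in> carrier_vec n" and v: "v \<in> V"
  shows "proj_perp n V x \<bullet> proj_perp n V x \<le> (x - v) \<bullet> (x - v)"
proof -
  let ?p = "proj_perp n V x"
  have c: "?p \<in> carrier_vec n" "v \<in> carrier_vec n" "x - ?p \<in> carrier_vec n"
    using proj_perp_props(1)[OF V x] v x lin_subspaceD(1)[OF V] by auto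
  have "x - v = ?p + ((x - ?p) - v)" using c x by (intro eq_vecI) auto
  moreover have "?p \<bullet> ((x - ?p) - v) = 0"
    by (rule proj_perp_props(2)[OF V x lin_subspace_minus[OF V proj_perp_props(3)[OF V x] v]])
  ultimately show ?thesis
    using scalar_prod_self_add[of ?p n "(x - ?p) - v"] scalar_prod_self_nonneg[of "(x - ?p) - v"] c
    by simp
qed

section \<open>Tensor products of vectors\<close>

text \<open>
  The coordinates are ordered as in \<^const>\<open>kron\<close>, with the index into the left factor varying slowest.
\<close>

definition vtensor :: "real vec \<Rightarrow> real vec \<Rightarrow> real vec" where
  "vtensor a b = vec (dim_vec a * dim_vec b) (\<lambda>i. a $ (i div dim_vec b) * b $ (i mod dim_vec b))"

lemma div_mod_less:
  assumes "(i::nat) < m * p"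
  shows "i div p < m" "i mod p < p"
  using assms by (auto simp: less_mult_imp_div_less intro!: mod_less_divisor Nat.gr0I)

lemma vtensor_carrier [simp]:
  "a \<in> carrier_vec m \<Longrightarrow> b \<in> carrier_vec p \<Longrightarrow> vtensor a b \<in> carrier_vec (m * p)"
  by (auto simp: vtensor_def)

lemma vtensor_bilinear:
  assumes "a \<in> carrier_vec m" "a' \<in> carrier_vec m" "b \<in> carrier_vec p" "b' \<in> carrier_vec p"
  shows vtensor_add_left: "vtensor (a + a') b = vtensor a b + vtensor a' b"
    and vtensor_add_right: "vtensor a (b + b') = vtensor a b + vtensor a b'"
    and vtensor_minus_left: "vtensor (a - a') b = vtensor a b - vtensor a' b"
    and vtensor_minus_right: "vtensor a (b - b') = vtensor a b - vtensor a b'"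
    and vtensor_smult_left: "vtensor (c \<cdot>\<^sub>v a) b = c \<cdot>\<^sub>v vtensor a b"
    and vtensor_smult_right: "vtensor a (c \<cdot>\<^sub>v b) = c \<cdot>\<^sub>v vtensor a b"
  using assms
  by (auto intro!: eq_vecI simp: vtensor_def algebra_simps div_mod_less[of _ m p])

lemma vtensor_zero:
  "b \<in> carrier_vec p \<Longrightarrow> vtensor (0\<^sub>v m) b = 0\<^sub>v (m * p)"
  "a \<in> carrier_vec m \<Longrightarrow> vtensor a (0\<^sub>v p) = 0\<^sub>v (m * p)"
  using div_mod_less by (auto intro!: eq_vecI simp: vtensor_def)

lemma sum_div_mod:
  fixes f :: "nat \<Rightarrow> nat \<Rightarrow> real"
  shows "(\<Sum>i<m * p. f (i div p) (i mod p)) = (\<Sum>i<m. \<Sum>j<p. f i j)"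
proof -
  have "(\<Sum>k\<in>{i * p..<i * p + p}. f (k div p) (k mod p)) = (\<Sum>j<p. f i j)" for i
  proof -
    have "(\<Sum>k\<in>{i * p..<i * p + p}. f (k div p) (k mod p)) =
        (\<Sum>j\<in>{0..<p}. f ((i * p + j) div p) ((i * p + j) mod p))"
      using sum.atLeastLessThan_shift_bounds[of "\<lambda>k. f (k div p) (k mod p)" 0 "i * p" p]
      by (simp add: add.commute comp_def)
    also have "\<dots> = (\<Sum>j\<in>{0..<p}. f i j)" by (rule sum.cong) auto
    finally show ?thesis by (simp add: atLeast0LessThan)
  qed
  then show ?thesis using sum.nat_group[of "\<lambda>k. f (k div p) (k mod p)" p m] by simp
qed

text \<open>
  The double sum over the coordinates factorizes.  Hence a tensor product is orthogonal to another one
  as soon as one pair of factors is orthogonal, which is all the orthogonality that the error analysis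
  needs.
\<close>

lemma scalar_prod_vtensor:
  assumes "a \<in> carrier_vec m" "b \<in> carrier_vec p" "c \<in> carrier_vec m" "d \<in> carrier_vec p"
  shows "vtensor a b \<bullet> vtensor c d = (a \<bullet> c) * (b \<bullet> d)"
proof -
  have "vtensor a b \<bullet> vtensor c d =
      (\<Sum>i<m * p. (a $ (i div p) * c $ (i div p)) * (b $ (i mod p) * d $ (i mod p)))"
    using assms by (auto simp: scalar_prod_def vtensor_def atLeast0LessThan intro!: sum.cong)
  also have "\<dots> = (\<Sum>i<m. \<Sum>j<p. (a $ i * c $ i) * (b $ j * d $ j))" by (rule sum_div_mod)
  also have "\<dots> = (a \<bullet> c) * (b \<bullet> d)"
    using assms by (simp add: scalar_prod_def atLeast0LessThan sum_product)
  finally show ?thesis .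
qed

lemma col_kron:
  assumes "j < dim_col A * dim_col B"
  shows "col (kron A B) j = vtensor (col A (j div dim_col B)) (col B (j mod dim_col B))"
  using assms div_mod_less
  by (auto intro!: eq_vecI simp: kron_def vtensor_def)

section \<open>Sparse approximation of tensor products\<close>

text \<open>
  The sparse tensor space of level \<open>K\<close> is generated by the tensor products of a basis of \<open>V k\<close> and a
  basis of \<open>W (K - k)\<close>, for \<open>k \<le> K\<close>.  By bilinearity it contains \<open>v \<otimes> w\<close> for all \<open>v \<in> V k\<close> and
  \<open>w \<in> W (K - k)\<close>: first extend from the basis to \<open>V k\<close> in the left factor, then in the right factor.
  If the dimensions grow like \<open>2 ^ k\<close>, all \<open>K + 1\<close> summands have the same order \<open>2 ^ K\<close>, whereas
  \<open>V K \<otimes> W K\<close> has dimension of order \<open>2 ^ (2 * K)\<close>.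
\<close>

lemma sparse_tensor_space:
  fixes V W :: "nat \<Rightarrow> real vec set"
  assumes V: "\<And>k. lin_subspace m (V k)" and W: "\<And>k. lin_subspace p (W k)"
  obtains U where "lin_subspace (m * p) U"
    "\<And>k v w. k \<le> K \<Longrightarrow> v \<in> V k \<Longrightarrow> w \<in> W (K - k) \<Longrightarrow> vtensor v w \<in> U"
    "sdim (m * p) U \<le> (\<Sum>k\<le>K. sdim m (V k) * sdim p (W (K - k)))"
proof -
  have "\<exists>B. finite B \<and> B \<subseteq> V k \<and> card B = sdim m (V k) \<and>
      (\<forall>X. lin_subspace m X \<longrightarrow> B \<subseteq> X \<longrightarrow> V k \<subseteq> X)" for k
    using lin_subspace_basis[OF V[of k]] by metis
  then obtain B where B: "\<And>k. finite (B k)" "\<And>k. B k \<subseteq> V k" "\<And>k. card (B k) = sdim m (V k)"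
    "\<And>k X. lin_subspace m X \<Longrightarrow> B k \<subseteq> X \<Longrightarrow> V k \<subseteq> X" by metis
  have "\<exists>C. finite C \<and> C \<subseteq> W k \<and> card C = sdim p (W k) \<and>
      (\<forall>X. lin_subspace p X \<longrightarrow> C \<subseteq> X \<longrightarrow> W k \<subseteq> X)" for k
    using lin_subspace_basis[OF W[of k]] by metis
  then obtain C where C: "\<And>k. finite (C k)" "\<And>k. C k \<subseteq> W k" "\<And>k. card (C k) = sdim p (W k)"
    "\<And>k X. lin_subspace p X \<Longrightarrow> C k \<subseteq> X \<Longrightarrow> W k \<subseteq> X" by metis
  note Vc = lin_subspaceD(1)[OF V] and Wc = lin_subspaceD(1)[OF W]
  define S where "S = (\<Union>k\<le>K. (\<lambda>(v, w). vtensor v w) ` (B k \<times> C (K - k)))"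
  have finS: "finite S" unfolding S_def using B(1) C(1) by auto
  have "vtensor v w \<in> carrier_vec (m * p)" if "v \<in> B k" "w \<in> C l" for v w k l
    using that B(2)[of k] C(2)[of l] Vc[of k] Wc[of l] by (intro vtensor_carrier) auto
  then have Sc: "S \<subseteq> carrier_vec (m * p)" unfolding S_def by auto
  obtain U where U: "lin_subspace (m * p) U" "S \<subseteq> U" "sdim (m * p) U \<le> card S"
    using lin_subspace_generated[OF finS Sc] .
  show ?thesis
  proof
    show "lin_subspace (m * p) U" by fact
    have "card S \<le> (\<Sum>k\<le>K. card ((\<lambda>(v, w). vtensor v w) ` (B k \<times> C (K - k))))"
      unfolding S_def by (rule card_UN_le) simp
    also have "\<dots> \<le> (\<Sum>k\<le>K. card (B k \<times> C (K - k)))"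
      by (rule sum_mono, rule card_image_le) (use B(1) C(1) in auto)
    also have "\<dots> = (\<Sum>k\<le>K. sdim m (V k) * sdim p (W (K - k)))"
      using B(3) C(3) by (simp add: card_cartesian_product)
    finally show "sdim (m * p) U \<le> (\<Sum>k\<le>K. sdim m (V k) * sdim p (W (K - k)))" using U(3) by simp
  next
    fix k v w assume k: "k \<le> K" and v: "v \<in> V k" and w: "w \<in> W (K - k)"
    note Ud = lin_subspaceD[OF U(1)]
    have vc: "v \<in> carrier_vec m" using v Vc by auto
    have L: "lin_subspace m {x \<in> carrier_vec m. vtensor x y \<in> U}" if "y \<in> carrier_vec p" for y
      by (rule lin_subspaceI) (use that Ud in \<open>auto simp: vtensor_add_left[of _ m _ y p y]
        vtensor_smult_left[of _ m _ y p y] vtensor_zero\<close>)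
    have R: "lin_subspace p {y \<in> carrier_vec p. vtensor v y \<in> U}"
      by (rule lin_subspaceI) (use vc Ud in \<open>auto simp: vtensor_add_right[of v m v _ p]
        vtensor_smult_right[of v m v _ p] vtensor_zero\<close>)
    have "vtensor v y \<in> U" if y: "y \<in> C (K - k)" for y
    proof -
      have yc: "y \<in> carrier_vec p" using y C(2) Wc by blast
      have "B k \<subseteq> {x \<in> carrier_vec m. vtensor x y \<in> U}"
        using B(2)[of k] Vc[of k] U(2) y k unfolding S_def by blast
      from B(4)[OF L[OF yc] this] show ?thesis using v by auto
    qed
    then have "C (K - k) \<subseteq> {y \<in> carrier_vec p. vtensor v y \<in> U}"
      using C(2)[of "K - k"] Wc[of "K - k"] by auto
    from C(4)[OF R this] show "vtensor v w \<in> U" using w by auto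
  qed
qed

lemma sdim_eq_0_iff:
  assumes V: "lin_subspace n V"
  shows "sdim n V = 0 \<longleftrightarrow> V = {0\<^sub>v n}"
proof -
  have Z: "lin_subspace n {0\<^sub>v n}" by (rule lin_subspaceI) auto
  have *: "X = {0\<^sub>v n}" if X: "lin_subspace n X" "sdim n X = 0" for X
  proof -
    obtain B where "finite B" "card B = sdim n X" "\<And>Y. lin_subspace n Y \<Longrightarrow> B \<subseteq> Y \<Longrightarrow> X \<subseteq> Y"
      using lin_subspace_basis[OF X(1)] by metis
    then have "X \<subseteq> {0\<^sub>v n}" using Z X(2) by auto
    then show ?thesis using lin_subspaceD(2)[OF X(1)] by auto
  qed
  obtain U where "lin_subspace n U" "sdim n U \<le> card ({} :: real vec set)"
    using lin_subspace_generated[of "{}" n] by auto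
  with *[of U] have "sdim n {0\<^sub>v n} = 0" by auto
  then show ?thesis using *[OF V] by auto
qed

text \<open>
  Write \<open>e k\<close> and \<open>f k\<close> for the components of \<open>a\<close> and \<open>b\<close> orthogonal to \<open>V k\<close> and \<open>W k\<close>.  Telescope
  \<open>a = d 0 + d 1 + \<dots> + d K + e K\<close> with \<open>d 0 = a - e 0\<close> and \<open>d (j + 1) = e j - e (j + 1) \<in> V (j + 1)\<close>; since
  the spaces are nested, these vectors are pairwise orthogonal.  Approximate \<open>d j \<otimes> b\<close> by
  \<open>d j \<otimes> (b - f (K - j)) \<in> V j \<otimes> W (K - j)\<close> and drop \<open>e K \<otimes> b\<close>.  What is left consists of the \<open>K + 2\<close>
  terms \<open>d j \<otimes> f (K - j)\<close> and \<open>e K \<otimes> b\<close>, pairwise orthogonal because their left factors are, so their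
  squared norms add up.  It is this orthogonality that makes the error grow with the square root of the
  number of levels only.
\<close>

lemma tensor_residual:
  fixes V W :: "nat \<Rightarrow> real vec set" and m p K :: nat
  defines "e \<equiv> \<lambda>k x. proj_perp m (V k) x" and "f \<equiv> \<lambda>k y. proj_perp p (W k) y"
  assumes V: "\<And>k. lin_subspace m (V k)" and mono: "\<And>k. V k \<subseteq> V (Suc k)"
    and W: "\<And>k. lin_subspace p (W k)"
    and U: "lin_subspace (m * p) U"
    and VWU: "\<And>k v w. k \<le> K \<Longrightarrow> v \<in> V k \<Longrightarrow> w \<in> W (K - k) \<Longrightarrow> vtensor v w \<in> U"
    and a: "a \<in> carrier_vec m" and b: "b \<in> carrier_vec p"
    and first: "(a \<bullet> a) * (f K b \<bullet> f K b) \<le> c"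
    and middle: "\<And>j. j < K \<Longrightarrow> (e j a \<bullet> e j a) * (f (K - Suc j) b \<bullet> f (K - Suc j) b) \<le> c"
    and last: "(e K a \<bullet> e K a) * (b \<bullet> b) \<le> c"
  shows "\<exists>t\<in>U. (vtensor a b - t) \<bullet> (vtensor a b - t) \<le> (real K + 2) * c"
proof -
  let ?t = vtensor
  have ec: "e k a \<in> carrier_vec m" for k unfolding e_def by (rule proj_perp_props(1)[OF V a])
  have eo: "e k a \<bullet> v = 0" if "v \<in> V k" for k v
    unfolding e_def by (rule proj_perp_props(2)[OF V a that])
  have ed: "a - e k a \<in> V k" for k unfolding e_def by (rule proj_perp_props(3)[OF V a])
  have fc: "f k b \<in> carrier_vec p" for k unfolding f_def by (rule proj_perp_props(1)[OF W b])
  have fd: "b - f k b \<in> W k" for k unfolding f_def by (rule proj_perp_props(3)[OF W b])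
  note Vc = lin_subspaceD(1)[OF V]
  have split_le: "(d \<bullet> d) * (y \<bullet> y) \<le> (x \<bullet> x) * (y \<bullet> y)"
    if "x = d + z" "d \<bullet> z = 0" "d \<in> carrier_vec m" "z \<in> carrier_vec m" for x d z y :: "real vec"
    using scalar_prod_self_add[of d m z] scalar_prod_self_nonneg[of z] scalar_prod_self_nonneg[of y] that
    by (intro mult_right_mono) auto
  \<comment> \<open>\<open>r\<close> is the part of the error produced up to level \<open>j\<close>.  All its left factors lie in \<open>V j\<close>, which
    is expressed by its orthogonality to every \<open>v \<otimes> w\<close> with \<open>v\<close> orthogonal to \<open>V j\<close>; this is what makes
    the next error term orthogonal to it.\<close>
  have P: "\<exists>r\<in>carrier_vec (m * p). ?t (a - e j a) b - r \<in> U \<and>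
      (\<forall>v\<in>carrier_vec m. \<forall>w\<in>carrier_vec p. (\<forall>u\<in>V j. v \<bullet> u = 0) \<longrightarrow> r \<bullet> ?t v w = 0) \<and>
      r \<bullet> r \<le> (real j + 1) * c" if "j \<le> K" for j
    using that
  proof (induction j)
    case 0
    let ?d = "a - e 0 a"
    let ?r = "?t ?d (f K b)"
    have dc: "?d \<in> carrier_vec m" using a ec by simp
    have "?t ?d (b - f K b) = ?t ?d b - ?r" by (rule vtensor_minus_right[OF dc dc b fc])
    then have "?t ?d b - ?r \<in> U" using VWU[of 0, OF _ ed fd] by simp
    moreover have "?r \<bullet> ?t v w = 0"
      if "v \<in> carrier_vec m" "w \<in> carrier_vec p" "\<forall>u\<in>V 0. v \<bullet> u = 0" for v w
      using that ed[of 0] comm_scalar_prod[OF dc that(1)]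
      by (simp add: scalar_prod_vtensor[OF dc fc that(1,2)])
    moreover have "?r \<bullet> ?r \<le> c"
    proof -
      have "(?d \<bullet> ?d) * (f K b \<bullet> f K b) \<le> (a \<bullet> a) * (f K b \<bullet> f K b)"
      proof (rule split_le[OF _ _ dc ec])
        show "a = ?d + e 0 a" using a ec[of 0] by (intro eq_vecI) auto
        show "?d \<bullet> e 0 a = 0" using eo[OF ed, of 0] comm_scalar_prod[OF dc ec[of 0]] by simp
      qed
      then show ?thesis using first by (simp add: scalar_prod_vtensor[OF dc fc dc fc])
    qed
    moreover have "?r \<in> carrier_vec (m * p)" using dc fc by simp
    ultimately show ?case by (intro bexI[of _ ?r]) auto
  next
    case (Suc j)
    then obtain r where r: "r \<in> carrier_vec (m * p)" "?t (a - e j a) b - r \<in> U"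
      "\<And>v w. v \<in> carrier_vec m \<Longrightarrow> w \<in> carrier_vec p \<Longrightarrow> \<forall>u\<in>V j. v \<bullet> u = 0 \<Longrightarrow> r \<bullet> ?t v w = 0"
      "r \<bullet> r \<le> (real j + 1) * c" by auto
    define d where "d = e j a - e (Suc j) a"
    let ?f = "f (K - Suc j) b"
    let ?r = "r + ?t d ?f"
    have dc: "d \<in> carrier_vec m" using ec by (simp add: d_def)
    have d_alt: "d = (a - e (Suc j) a) - (a - e j a)"
      unfolding d_def using a ec[of j] ec[of "Suc j"] by (intro eq_vecI) auto
    have dV: "d \<in> V (Suc j)"
      unfolding d_alt using ed[of "Suc j"] ed[of j] mono[of j] lin_subspace_minus[OF V] by blast
    have do: "d \<bullet> u = 0" if "u \<in> V j" for u
    proof -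
      have "u \<in> carrier_vec m" using that Vc by auto
      then have "d \<bullet> u = e j a \<bullet> u - e (Suc j) a \<bullet> u"
        unfolding d_def using ec by (intro minus_scalar_prod_distrib) auto
      then show ?thesis using eo that mono by auto
    qed
    have tc: "?t d ?f \<in> carrier_vec (m * p)" using dc fc by simp
    have "?t (a - e (Suc j) a) b - ?r = (?t (a - e j a) b - r) + ?t d (b - ?f)"
    proof -
      have "a - e (Suc j) a = (a - e j a) + d"
        unfolding d_def using a ec[of j] ec[of "Suc j"] by (intro eq_vecI) auto
      then have "?t (a - e (Suc j) a) b = ?t (a - e j a) b + ?t d b"
        using vtensor_add_left[of "a - e j a" m d b p b] a ec dc b by simp
      moreover have "?t d (b - ?f) = ?t d b - ?t d ?f"
        by (rule vtensor_minus_right[OF dc dc b fc])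
      moreover have "?t (a - e j a) b \<in> carrier_vec (m * p)" "?t d b \<in> carrier_vec (m * p)"
        using a ec b dc by auto
      ultimately show ?thesis using r(1) tc by (intro eq_vecI) auto
    qed
    moreover have "?t d (b - ?f) \<in> U" using VWU[OF Suc.prems dV fd] .
    ultimately have "?t (a - e (Suc j) a) b - ?r \<in> U"
      using r(2) lin_subspaceD(3)[OF U] by simp
    moreover have "?r \<bullet> ?t v w = 0"
      if vw: "v \<in> carrier_vec m" "w \<in> carrier_vec p" "\<forall>u\<in>V (Suc j). v \<bullet> u = 0" for v w
    proof -
      have "?r \<bullet> ?t v w = r \<bullet> ?t v w + ?t d ?f \<bullet> ?t v w"
        using r(1) tc vw by (intro add_scalar_prod_distrib) auto
      moreover have "d \<bullet> v = 0" using vw(3) dV comm_scalar_prod[OF dc vw(1)] by auto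
      ultimately show ?thesis
        using r(3)[OF vw(1,2)] vw(3) mono[of j] by (auto simp: scalar_prod_vtensor[OF dc fc vw(1,2)])
    qed
    moreover have "?r \<bullet> ?r \<le> (real (Suc j) + 1) * c"
    proof -
      have "(d \<bullet> d) * (?f \<bullet> ?f) \<le> (e j a \<bullet> e j a) * (?f \<bullet> ?f)"
      proof (rule split_le[OF _ _ dc ec])
        show "e j a = d + e (Suc j) a"
          unfolding d_def using ec[of j] ec[of "Suc j"] by (intro eq_vecI) auto
        show "d \<bullet> e (Suc j) a = 0" using eo[OF dV] comm_scalar_prod[OF dc ec[of "Suc j"]] by simp
      qed
      also have "\<dots> \<le> c" using middle Suc.prems by simp
      finally have "?t d ?f \<bullet> ?t d ?f \<le> c" by (simp add: scalar_prod_vtensor[OF dc fc dc fc])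
      moreover have "r \<bullet> ?t d ?f = 0" using r(3)[OF dc fc] do by simp
      ultimately show ?thesis
        using scalar_prod_self_add[OF r(1) tc] r(4) by (simp add: algebra_simps)
    qed
    moreover have "?r \<in> carrier_vec (m * p)" using r(1) tc by simp
    ultimately show ?case by (intro bexI[of _ ?r]) auto
  qed
  obtain r where r: "r \<in> carrier_vec (m * p)" "?t (a - e K a) b - r \<in> U"
    "\<And>v w. v \<in> carrier_vec m \<Longrightarrow> w \<in> carrier_vec p \<Longrightarrow> \<forall>u\<in>V K. v \<bullet> u = 0 \<Longrightarrow> r \<bullet> ?t v w = 0"
    "r \<bullet> r \<le> (real K + 1) * c" using P[of K] by auto
  let ?u = "?t (a - e K a) b - r"
  have tc: "?t (e K a) b \<in> carrier_vec (m * p)" "?t a b \<in> carrier_vec (m * p)" using ec b a by auto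
  have "?t (a - e K a) b = ?t a b - ?t (e K a) b" by (rule vtensor_minus_left[OF a ec b b])
  then have "?t a b - ?u = r + ?t (e K a) b" using tc r(1) by (intro eq_vecI) auto
  moreover have "r \<bullet> ?t (e K a) b = 0" using r(3)[OF ec b] eo by blast
  moreover have "?t (e K a) b \<bullet> ?t (e K a) b \<le> c"
    using last by (simp add: scalar_prod_vtensor[OF ec b ec b])
  ultimately have "(?t a b - ?u) \<bullet> (?t a b - ?u) \<le> (real K + 2) * c"
    using scalar_prod_self_add[OF r(1) tc(1)] r(4) by (simp add: algebra_simps)
  then show ?thesis using r(2) by blast
qed

section \<open>The approximation numbers\<close>

lemma norm2_le_iff: "e \<ge> 0 \<Longrightarrow> norm2 x \<le> e \<longleftrightarrow> x \<bullet> x \<le> e\<^sup>2"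
  using power_mono_iff[of "norm2 x" e 2] by (simp add: norm2_def scalar_prod_self_nonneg)

lemma norm2_nonneg: "norm2 x \<ge> 0"
  by (simp add: norm2_def scalar_prod_self_nonneg)

lemma norm2_proj_perp_le_delta:
  "j < dim_col X \<Longrightarrow> norm2 (proj_perp (dim_row X) V (col X j)) \<le> delta V X"
  unfolding delta_def by (intro Max_ge) auto

text \<open>
  Both the least \<open>N\<close> in \<^const>\<open>M_approx\<close> and the infimum in \<^const>\<open>delta_N\<close> are bounded by what a single
  subspace achieves.  For the infimum this needs a lower bound of the values, which is 0.
\<close>

lemma M_approx_le_sdim:
  assumes U: "lin_subspace (dim_row X) U" and pos: "sdim (dim_row X) U \<ge> 1"
    and col: "dim_col X \<ge> 1" and \<epsilon>: "\<epsilon> \<ge> 0"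
    and approx: "\<And>j. j < dim_col X \<Longrightarrow> \<exists>t\<in>U. (col X j - t) \<bullet> (col X j - t) \<le> \<epsilon>\<^sup>2"
  shows "M_approx \<epsilon> X \<le> sdim (dim_row X) U"
proof -
  let ?n = "dim_row X"
  have "norm2 (proj_perp ?n U (col X j)) \<le> \<epsilon>" if j: "j < dim_col X" for j
  proof -
    obtain t where "t \<in> U" "(col X j - t) \<bullet> (col X j - t) \<le> \<epsilon>\<^sup>2" using approx[OF j] by blast
    then show ?thesis using proj_perp_le[OF U, of "col X j" t] \<epsilon> by (simp add: norm2_le_iff)
  qed
  then have dU: "delta U X \<le> \<epsilon>" unfolding delta_def using col
    by (subst Max_le_iff) (auto simp: lessThan_empty_iff)
  have "delta V X \<ge> 0" for V
    using norm2_proj_perp_le_delta[of 0 X V] norm2_nonneg[of "proj_perp ?n V (col X 0)"] col by simp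
  then have "bdd_below {delta V X | V. lin_subspace ?n V \<and> sdim ?n V = sdim ?n U}"
    by (auto intro!: bdd_belowI[of _ 0])
  then have "delta_N (sdim ?n U) X \<le> delta U X"
    unfolding delta_N_def using U by (intro cInf_lower) auto
  moreover have "sdim ?n U \<le> ?n" using lin_subspace_basis[OF U] by metis
  ultimately show ?thesis unfolding M_approx_def using pos dU by (intro Least_le) auto
qed

text \<open>
  The non-asymptotic estimate.  With \<open>G\<close> in place of \<open>\<gamma>\<close> the decay of the residuals of the columns
  also holds at level 0, where it follows from the normalization of the columns.  A product of residuals
  at the levels \<open>j\<close> and \<open>K - (j + 1)\<close> then has a bound independent of \<open>j\<close>; the two levels add up to
  \<open>K - 1\<close> instead of \<open>K\<close>, which costs the factor \<open>2 powr (1 / W)\<close>.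
\<close>

lemma M_approx_kron_le:
  assumes nested: "nested_approximations q \<gamma> W \<Psi> V"
    and q: "q \<ge> 1" and W: "W > 0" and col: "dim_col \<Psi> \<ge> 1"
    and unit: "\<And>j. j < dim_col \<Psi> \<Longrightarrow> norm2 (col \<Psi> j) \<le> 1"
    and G: "G \<ge> 1" "G \<ge> \<gamma>" and \<epsilon>: "\<epsilon> \<ge> 0"
    and small: "(real K + 2) * (G\<^sup>2 * 2 powr (1 / W) * 2 powr (- real K / W))\<^sup>2 \<le> \<epsilon>\<^sup>2"
  shows "real (M_approx \<epsilon> (kron \<Psi> \<Psi>)) \<le> (real q)\<^sup>2 * ((real K + 1) * 2 ^ K)"
proof -
  define m where "m = dim_row \<Psi>"
  define c where "c = (G\<^sup>2 * 2 powr (1 / W) * 2 powr (- real K / W))\<^sup>2"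
  have V: "lin_subspace m (V k)" for k
    using nested by (cases k) (auto simp: nested_approximations_def nested_spaces_def m_def)
  have mono: "V k \<subseteq> V (Suc k)" for k
    using nested unfolding nested_approximations_def nested_spaces_def
    by (metis diff_Suc_1 le_add1 plus_1_eq_Suc)
  have dim0: "sdim m (V 0) = q"
    using nested by (auto simp: nested_approximations_def nested_spaces_def m_def)
  have dim: "sdim m (V k) \<le> q * 2 ^ k" for k
    using nested by (cases k) (auto simp: nested_approximations_def nested_spaces_def m_def)
  define e where "e k x = proj_perp m (V k) x" for k x
  have decay: "e k (col \<Psi> j) \<bullet> e k (col \<Psi> j) \<le> (G * 2 powr (- real k / W))\<^sup>2"
    if j: "j < dim_col \<Psi>" for k j
  proof (cases "k = 0")
    case True
    have x: "col \<Psi> j \<in> carrier_vec m" by (simp add: m_def)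
    have "e 0 (col \<Psi> j) \<bullet> e 0 (col \<Psi> j) \<le> col \<Psi> j \<bullet> col \<Psi> j"
      using proj_perp_le[OF V x lin_subspaceD(2)[OF V], of 0] x by (simp add: e_def)
    also have "\<dots> \<le> 1" using unit[OF j] by (simp add: norm2_le_iff)
    also have "\<dots> \<le> G\<^sup>2" using G by simp
    finally show ?thesis using True by simp
  next
    case False
    have "norm2 (e k (col \<Psi> j)) \<le> delta (V k) \<Psi>"
      using norm2_proj_perp_le_delta[OF j] by (simp add: e_def m_def)
    also have "\<dots> \<le> \<gamma> * 2 powr (- real k / W)"
      using nested False by (auto simp: nested_approximations_def)
    also have "\<dots> \<le> G * 2 powr (- real k / W)" using G by (intro mult_right_mono) auto
    finally show ?thesis using G by (subst (asm) norm2_le_iff) auto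
  qed
  have unit': "col \<Psi> j \<bullet> col \<Psi> j \<le> 1" if "j < dim_col \<Psi>" for j
    using unit[OF that] by (simp add: norm2_le_iff)
  have end_le: "(G * 2 powr (- real K / W))\<^sup>2 \<le> c"
  proof -
    have "1 \<le> G * 2 powr (1 / W)"
      using G W mult_mono[of 1 G 1 "2 powr (1 / W)"] by (simp add: ge_one_powr_ge_zero)
    from mult_right_mono[OF this, of "G * 2 powr (- real K / W)"]
    have "G * 2 powr (- real K / W) \<le> G\<^sup>2 * 2 powr (1 / W) * 2 powr (- real K / W)"
      using G by (simp add: power2_eq_square mult_ac)
    then show ?thesis unfolding c_def using G by (intro power_mono) auto
  qed
  obtain U where U: "lin_subspace (m * m) U"
    "\<And>k v w. k \<le> K \<Longrightarrow> v \<in> V k \<Longrightarrow> w \<in> V (K - k) \<Longrightarrow> vtensor v w \<in> U"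
    "sdim (m * m) U \<le> (\<Sum>k\<le>K. sdim m (V k) * sdim m (V (K - k)))"
    using sparse_tensor_space[of m V m V K, OF V V] by blast
  have approx: "\<exists>t\<in>U. (vtensor (col \<Psi> i) (col \<Psi> j) - t) \<bullet> (vtensor (col \<Psi> i) (col \<Psi> j) - t) \<le> \<epsilon>\<^sup>2"
    if i: "i < dim_col \<Psi>" and j: "j < dim_col \<Psi>" for i j
  proof -
    let ?a = "col \<Psi> i" and ?b = "col \<Psi> j"
    have ab: "?a \<in> carrier_vec m" "?b \<in> carrier_vec m" by (auto simp: m_def)
    have "(?a \<bullet> ?a) * (e K ?b \<bullet> e K ?b) \<le> 1 * (G * 2 powr (- real K / W))\<^sup>2"
      by (intro mult_mono unit' decay i j) (auto simp: scalar_prod_self_nonneg)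
    then have first: "(?a \<bullet> ?a) * (e K ?b \<bullet> e K ?b) \<le> c" using end_le by simp
    have "(e K ?a \<bullet> e K ?a) * (?b \<bullet> ?b) \<le> (G * 2 powr (- real K / W))\<^sup>2 * 1"
      by (intro mult_mono unit' decay i j) (auto simp: scalar_prod_self_nonneg)
    then have last: "(e K ?a \<bullet> e K ?a) * (?b \<bullet> ?b) \<le> c" using end_le by simp
    have middle: "(e l ?a \<bullet> e l ?a) * (e (K - Suc l) ?b \<bullet> e (K - Suc l) ?b) \<le> c" if l: "l < K" for l
    proof -
      have "(e l ?a \<bullet> e l ?a) * (e (K - Suc l) ?b \<bullet> e (K - Suc l) ?b)
          \<le> (G * 2 powr (- real l / W))\<^sup>2 * (G * 2 powr (- real (K - Suc l) / W))\<^sup>2"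
        by (intro mult_mono decay i j) (auto simp: scalar_prod_self_nonneg)
      also have "\<dots> = (G\<^sup>2 * (2 powr (- real l / W) * 2 powr (- real (K - Suc l) / W)))\<^sup>2"
        by (simp add: power2_eq_square mult_ac)
      also have "2 powr (- real l / W) * 2 powr (- real (K - Suc l) / W)
          = (2 powr (1 / W) * 2 powr (- real K / W) :: real)"
        unfolding powr_add[symmetric] add_divide_distrib[symmetric] using l by (simp add: of_nat_diff)
      finally show ?thesis by (simp add: c_def mult_ac)
    qed
    have "\<exists>t\<in>U. (vtensor ?a ?b - t) \<bullet> (vtensor ?a ?b - t) \<le> (real K + 2) * c"
      by (rule tensor_residual[where V = V and W = V and K = K])
         (fact V mono U(1) U(2) ab first[unfolded e_def] middle[unfolded e_def] last[unfolded e_def])+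
    then show ?thesis using small unfolding c_def by (blast intro: order_trans)
  qed
  let ?X = "kron \<Psi> \<Psi>"
  have X: "dim_row ?X = m * m" "dim_col ?X = dim_col \<Psi> * dim_col \<Psi>" by (auto simp: kron_def m_def)
  \<comment> \<open>\<^const>\<open>M_approx\<close> ranges over positive dimensions only, so the zero space has to be excluded.\<close>
  have "U \<noteq> {0\<^sub>v (m * m)}"
  proof
    assume U0: "U = {0\<^sub>v (m * m)}"
    have "V 0 \<noteq> {0\<^sub>v m}" using sdim_eq_0_iff[OF V[of 0]] dim0 q by auto
    then obtain v where v: "v \<in> V 0" "v \<noteq> 0\<^sub>v m" using lin_subspaceD(2)[OF V[of 0]] by blast
    have "V 0 \<subseteq> V K" by (rule lift_Suc_mono_le[of V]) (simp_all add: mono)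
    then have "vtensor v v \<in> U" using v U(2)[of 0 v v] by auto
    then have "vtensor v v \<bullet> vtensor v v = 0" using U0 by simp
    moreover have vc: "v \<in> carrier_vec m" using v lin_subspaceD(1)[OF V] by blast
    ultimately show False using scalar_prod_self_eq_0[OF vc] v(2) scalar_prod_vtensor[OF vc vc vc vc]
      by simp
  qed
  then have "sdim (m * m) U \<ge> 1" using sdim_eq_0_iff[OF U(1)] by simp
  then have "M_approx \<epsilon> ?X \<le> sdim (m * m) U"
    using M_approx_le_sdim[of ?X U \<epsilon>] U(1) X col \<epsilon> approx div_mod_less
    by (simp add: col_kron)
  also have "\<dots> \<le> (\<Sum>k\<le>K. sdim m (V k) * sdim m (V (K - k)))" by (rule U(3))
  also have "\<dots> \<le> (\<Sum>k\<le>K. (q * 2 ^ k) * (q * 2 ^ (K - k)))"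
    by (intro sum_mono mult_mono dim) auto
  also have "\<dots> = (\<Sum>k\<le>K. q\<^sup>2 * 2 ^ K)"
    by (intro sum.cong) (auto simp: power2_eq_square mult_ac simp flip: power_add)
  finally have "real (M_approx \<epsilon> ?X) \<le> real (\<Sum>k\<le>K. q\<^sup>2 * 2 ^ K)" by (simp only: of_nat_le_iff)
  then show ?thesis by (simp add: algebra_simps)
qed

section \<open>Choice of the level\<close>

text \<open>
  With \<open>L = ln (1 / \<epsilon>)\<close>, the error \<open>sqrt (K + 2) * B * 2 powr (- K / W)\<close> is of order \<open>\<epsilon>\<close> when
  \<open>2 ^ K\<close> is about \<open>(A * sqrt L / \<epsilon>) powr W\<close>: then \<open>K\<close> is of order \<open>L\<close>, and \<open>sqrt L\<close> compensates the
  factor \<open>sqrt (K + 2)\<close>.  The dimension \<open>(K + 1) * 2 ^ K\<close> has order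
  \<open>L * (sqrt L / \<epsilon>) powr W = \<epsilon> powr (- W) * L powr ((2 + W) / 2)\<close>.
\<close>

lemma resolution_level:
  fixes B W :: real
  assumes B: "B > 0" and W: "W > 0"
  shows "\<exists>C. \<forall>\<^sub>F \<epsilon> in at_right 0. \<exists>K.
    (real K + 2) * (B * 2 powr (- real K / W))\<^sup>2 \<le> \<epsilon>\<^sup>2 \<and>
    (real K + 1) * 2 ^ K \<le> C * (\<epsilon> powr (- W) * ln (1 / \<epsilon>) powr ((2 + W) / 2))"
proof -
  \<comment> \<open>\<open>C1 * L\<close> bounds \<open>K + 2\<close> for small \<open>\<epsilon>\<close>.  The leading term of \<open>K\<close> is \<open>(W / ln 2) * L\<close>, whatever \<open>A\<close>
    is, and the summand 1 absorbs the lower order terms.  Thus \<open>C1\<close> is available for choosing \<open>A\<close>.\<close>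
  define C1 where "C1 = W / ln 2 + 1"
  define A where "A = B * sqrt C1"
  have C1: "C1 > 0" using W by (simp add: C1_def add_pos_pos)
  have A: "A > 0" using B C1 by (simp add: A_def)
  define x where "x \<epsilon> = W * log 2 (A * sqrt (ln (1 / \<epsilon>)) / \<epsilon>)" for \<epsilon>
  define w where "w = W / ln 2"
  \<comment> \<open>Of the 3 below, 2 is the summand in \<open>K + 2\<close> and 1 is due to rounding up in the choice of \<open>K\<close>.\<close>
  have "w > 0" using W by (simp add: w_def)
  then have "\<forall>\<^sub>F \<epsilon> in at_right 0. w * ln (A * sqrt (ln (1 / \<epsilon>))) + 3 \<le> ln (1 / \<epsilon>)"
    using A by real_asymp
  moreover have "\<forall>\<^sub>F \<epsilon> in at_right 0. 0 \<le> x \<epsilon>"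
    unfolding x_def using W A by real_asymp
  moreover have "\<forall>\<^sub>F \<epsilon> in at_right (0::real). 0 < \<epsilon>" by (rule eventually_at_right_less)
  moreover have "\<forall>\<^sub>F \<epsilon> in at_right (0::real). 0 < ln (1 / \<epsilon>)" by real_asymp
  ultimately have "\<forall>\<^sub>F \<epsilon> in at_right 0. \<exists>K.
    (real K + 2) * (B * 2 powr (- real K / W))\<^sup>2 \<le> \<epsilon>\<^sup>2 \<and>
    (real K + 1) * 2 ^ K \<le> (2 * C1 * A powr W) * (\<epsilon> powr (- W) * ln (1 / \<epsilon>) powr ((2 + W) / 2))"
  proof eventually_elim
    case (elim \<epsilon>)
    define L where "L = ln (1 / \<epsilon>)"
    have \<epsilon>: "\<epsilon> > 0" and L: "L > 0" using elim by (auto simp: L_def)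
    define y where "y = A * sqrt L / \<epsilon>"
    have y: "y > 0" using A L \<epsilon> by (simp add: y_def)
    have xy: "x \<epsilon> = W * log 2 y" by (simp add: x_def y_def L_def)
    define K where "K = nat \<lceil>x \<epsilon>\<rceil>"
    have K: "x \<epsilon> \<le> real K" "real K \<le> x \<epsilon> + 1" using elim by (auto simp: K_def)
    have "x \<epsilon> = w * ln (A * sqrt L) + w * L"
      using A L \<epsilon> by (simp add: x_def w_def log_def L_def ln_div ln_mult field_simps)
    then have KL: "real K + 2 \<le> C1 * L"
      using K elim(1) by (simp add: L_def C1_def w_def algebra_simps)
    have "2 powr (- real K / W) \<le> 2 powr (- log 2 y)"
      using K(1) W by (intro powr_mono) (auto simp: xy field_simps)
    also have "\<dots> = 1 / y" using y by (simp add: powr_minus divide_inverse)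
    finally have "(B * 2 powr (- real K / W))\<^sup>2 \<le> (B * (1 / y))\<^sup>2"
      using B by (intro power_mono mult_left_mono) auto
    then have "(real K + 2) * (B * 2 powr (- real K / W))\<^sup>2 \<le> (C1 * L) * (B * (1 / y))\<^sup>2"
      using KL C1 L by (intro mult_mono) auto
    also have "\<dots> = \<epsilon>\<^sup>2"
      using B C1 L \<epsilon> by (simp add: y_def A_def power_mult_distrib power_divide)
    finally have 1: "(real K + 2) * (B * 2 powr (- real K / W))\<^sup>2 \<le> \<epsilon>\<^sup>2" .
    have "(2::real) ^ K = 2 powr real K" by (simp add: powr_realpow)
    also have "\<dots> \<le> 2 powr (x \<epsilon> + 1)" using K(2) by (intro powr_mono) auto
    also have "\<dots> = 2 * (2 powr log 2 y) powr W" by (simp add: powr_add powr_powr xy mult.commute)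
    also have "\<dots> = 2 * y powr W" using y by simp
    also have "y powr W = (A * sqrt L) powr W / \<epsilon> powr W"
      using A L \<epsilon> by (simp add: y_def powr_divide)
    also have "(A * sqrt L) powr W = A powr W * L powr (W / 2)"
      using A L by (simp add: powr_mult powr_powr flip: powr_half_sqrt)
    also have "A powr W * L powr (W / 2) / \<epsilon> powr W = A powr W * L powr (W / 2) * \<epsilon> powr (- W)"
      by (simp add: powr_minus_divide)
    finally have "2 ^ K \<le> 2 * (A powr W * L powr (W / 2) * \<epsilon> powr (- W))" .
    then have "(real K + 1) * 2 ^ K \<le> (C1 * L) * (2 * (A powr W * L powr (W / 2) * \<epsilon> powr (- W)))"
      using KL C1 L by (intro mult_mono) auto
    also have "\<dots> = (2 * C1 * A powr W) * (\<epsilon> powr (- W) * (L powr 1 * L powr (W / 2)))"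
      using L by (simp add: mult_ac)
    also have "L powr 1 * L powr (W / 2) = L powr ((2 + W) / 2)"
      unfolding powr_add[symmetric] by (simp add: add_divide_distrib)
    finally show ?case using 1 by (intro exI[of _ K]) (simp add: L_def)
  qed
  then show ?thesis by blast
qed

section \<open>The asymptotic bound\<close>

theorem theorem4p3:
  fixes q :: nat and \<gamma> W :: real
  assumes "q \<ge> 1" and "\<gamma> > 0" and "W > 0"
  shows "dimfree_lesssim
    {\<Psi>. \<exists>m r. m \<ge> 1 \<and> r \<ge> 1 \<and> \<Psi> \<in> carrier_mat m r \<and>
         (MAX j\<in>{..<r}. norm2 (col \<Psi> j)) \<le> 1 \<and>
         (\<exists>V. nested_approximations q \<gamma> W \<Psi> V)}
    (\<lambda>\<Psi> \<epsilon>. real (M_approx \<epsilon> (kron \<Psi> \<Psi>)))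
    (\<lambda>\<epsilon>. \<epsilon> powr (- W) * ln (1 / \<epsilon>) powr ((2 + W) / 2))"
    (is "dimfree_lesssim ?I ?h ?g")
proof -
  define G where "G = max 1 \<gamma>"
  define B where "B = G\<^sup>2 * 2 powr (1 / W)"
  have G: "G \<ge> 1" "G \<ge> \<gamma>" by (auto simp: G_def)
  have "B > 0" using G by (simp add: B_def)
  then obtain C where C: "\<forall>\<^sub>F \<epsilon> in at_right 0. \<exists>K.
      (real K + 2) * (B * 2 powr (- real K / W))\<^sup>2 \<le> \<epsilon>\<^sup>2 \<and> (real K + 1) * 2 ^ K \<le> C * ?g \<epsilon>"
    using resolution_level[OF _ assms(3)] by blast
  have "\<forall>\<^sub>F \<epsilon> in at_right (0::real). 0 < ln (1 / \<epsilon>)" by real_asymp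
  with eventually_at_right_less[of "0::real"]
  have pos: "\<forall>\<^sub>F \<epsilon> in at_right (0::real). 0 < \<epsilon> \<and> 0 < ln (1 / \<epsilon>)"
    by (rule eventually_conj)
  have "\<forall>\<^sub>F \<epsilon> in at_right 0. (SUP \<Psi>\<in>?I. ereal (?h \<Psi> \<epsilon> / ?g \<epsilon>)) \<le> ereal ((real q)\<^sup>2 * C)"
    using C pos
  proof eventually_elim
    case (elim \<epsilon>)
    then obtain K where K: "(real K + 2) * (B * 2 powr (- real K / W))\<^sup>2 \<le> \<epsilon>\<^sup>2"
      "(real K + 1) * 2 ^ K \<le> C * ?g \<epsilon>" by blast
    have g: "?g \<epsilon> > 0"
    proof (rule mult_pos_pos)
      show "\<epsilon> powr (- W) > 0" "ln (1 / \<epsilon>) powr ((2 + W) / 2) > 0"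
        unfolding powr_gt_zero using elim(2) by linarith+
    qed
    show ?case
    proof (rule SUP_least)
      fix \<Psi> assume "\<Psi> \<in> ?I"
      then obtain m r V where \<Psi>: "r \<ge> 1" "\<Psi> \<in> carrier_mat m r"
        "(MAX j\<in>{..<r}. norm2 (col \<Psi> j)) \<le> 1" "nested_approximations q \<gamma> W \<Psi> V" by blast
      have unit: "norm2 (col \<Psi> j) \<le> 1" if "j < dim_col \<Psi>" for j
        using \<Psi>(2,3) that by (intro order_trans[OF Max_ge \<Psi>(3)]) auto
      have "?h \<Psi> \<epsilon> \<le> (real q)\<^sup>2 * ((real K + 1) * 2 ^ K)"
        using M_approx_kron_le[OF \<Psi>(4) assms(1,3) _ unit G, of \<epsilon> K] K(1) \<Psi>(1,2) elim
        by (simp add: B_def)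
      also have "\<dots> \<le> (real q)\<^sup>2 * (C * ?g \<epsilon>)" using K(2) by (intro mult_left_mono) auto
      finally show "ereal (?h \<Psi> \<epsilon> / ?g \<epsilon>) \<le> ereal ((real q)\<^sup>2 * C)"
        using g by (simp add: pos_divide_le_eq mult_ac)
    qed
  qed
  then have "Limsup (at_right 0) (\<lambda>\<epsilon>. SUP \<Psi>\<in>?I. ereal (?h \<Psi> \<epsilon> / ?g \<epsilon>)) \<le> ereal ((real q)\<^sup>2 * C)"
    by (rule Limsup_bounded)
  then show ?thesis unfolding dimfree_lesssim_def by blast
qed

end
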